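(* Let $m=3$ and let $n>3$ be an integer. Then there exist designs $(A,c)$ with $A\in\mathbb{R}_{\ge 0}^{3\times n}$ and $c\in\mathbb{R}_{\ge 0}^n$ that satisfy both $|\mathcal{L}^3(A,c)|\ge 2n-5$ and $|\mathcal{L}^2(A,c)|\ge 3n-6$.
   Context: For $A\in\mathbb{R}_{\ge0}^{m\times n}$, $c\in\mathbb{R}_{\ge0}^n$, $b\in\mathbb{R}_{\ge0}^m$, let $LP(A,c,b)$ be the linear program $\max\{c^\top x \mid Ax\le b,\ x\ge 0\}$. The pair $(A,c)$ is called a design. For $x\in\mathbb{R}^n_{\ge0}$, $\mathrm{supp}(x)=\{i\in[n]\mid x_i>0\}$, where $[n]=\{1,\dots,n\}$. A set $L\subseteq[n]$ is a loadout of $(A,c)$ if there exists $b\in\mathbb{R}^m_{\ge 0}$ such that $LP(A,c,b)$ has a unique optimal solution $x^*$ and $\mathrm{supp}(x^* )=L$. A loadout with $|L|=k$ is a $k$-loadout, and $\mathcal{L}^k(A,c)$ is the set of all $k$-loadouts of $(A,c)$. *)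

theory Defs
  imports Complex_Main "Jordan_Normal_Form.Matrix"
begin

text \<open>
  Following the matrix library, the index set \<open>[n]\<close> is represented by \<open>{0..<n}\<close>
  rather than \<open>{1..n}\<close>. The order \<open>\<le>\<close> on vectors is componentwise and includes equality of
  dimensions, so \<open>0\<^sub>v n \<le> x\<close> says that \<open>x\<close> is a nonnegative vector of dimension \<open>n\<close>.
\<close>

definition design :: "nat \<Rightarrow> nat \<Rightarrow> real mat \<Rightarrow> real vec \<Rightarrow> bool" where
  "design m n A c \<longleftrightarrow>
     A \<in> carrier_mat m n \<and> (\<forall>i<m. \<forall>j<n. 0 \<le> A $$ (i, j)) \<and>
     c \<in> carrier_vec n \<and> 0\<^sub>v n \<le> c"

definition lp_feasible :: "real mat \<Rightarrow> real vec \<Rightarrow> real vec set" where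
  "lp_feasible A b = {x \<in> carrier_vec (dim_col A). A *\<^sub>v x \<le> b \<and> 0\<^sub>v (dim_col A) \<le> x}"

definition lp_optimal :: "real mat \<Rightarrow> real vec \<Rightarrow> real vec \<Rightarrow> real vec \<Rightarrow> bool" where
  "lp_optimal A c b x \<longleftrightarrow>
     x \<in> lp_feasible A b \<and> (\<forall>y \<in> lp_feasible A b. c \<bullet> y \<le> c \<bullet> x)"

definition supp :: "real vec \<Rightarrow> nat set" where
  "supp x = {i. i < dim_vec x \<and> x $ i > 0}"

definition loadout :: "real mat \<Rightarrow> real vec \<Rightarrow> nat set \<Rightarrow> bool" where
  "loadout A c L \<longleftrightarrow>
     (\<exists>b \<in> carrier_vec (dim_row A). 0\<^sub>v (dim_row A) \<le> b \<and>
        (\<exists>x. lp_optimal A c b x \<and> (\<forall>y. lp_optimal A c b y \<longrightarrow> y = x) \<and> supp x = L))"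

definition loadouts :: "nat \<Rightarrow> real mat \<Rightarrow> real vec \<Rightarrow> nat set set" where
  "loadouts k A c = {L. loadout A c L \<and> card L = k}"

end

(* If a positive dual vector y has slack zero exactly on L and the columns of A indexed by L are
   independent, then L is a loadout by complementary slackness. So it suffices to realise a
   triangulation of n points with a triangular hull, which has 2n-5 triangles and 3n-6 edges, as
   a lower envelope with positive normals. The triangulation used here joins the points
   0 and 1 to each other and to every vertex of the path 2, ..., n-1. Points 0 and 1 are unit
   vectors of cost 1, and the path vertex j is (1, 1, k^2) with cost 8k, where k = j - 1. The
   slack of a dual vector (u, v, w) at this vertex is the quadratic u + v + w k^2 - 8k;
   prescribing its roots selects a vertex or an edge of the path, and u = 1 or v = 1 adds the
   point 0 or 1. *)

theory Submission
  imports Defs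
begin

section \<open>Dual certificates for unique optima\<close>

text \<open>Take for \<open>x\<close> the indicator vector of \<open>L\<close> and put
  \<open>b = A *\<^sub>v x\<close>, so that every row is tight at \<open>x\<close>. Since
  \<open>y\<close> is positive on all rows and the slack is positive off \<open>L\<close>, any
  optimum has all rows tight and vanishes off \<open>L\<close>; \<open>indep\<close> then forces it
  to equal \<open>x\<close>.\<close>

lemma loadout_if_dual:
  fixes A :: "real mat" and c :: "real vec" and y :: "nat \<Rightarrow> real"
  assumes A: "A \<in> carrier_mat m n" and c: "c \<in> carrier_vec n"
    and nonneg: "\<And>i j. i < m \<Longrightarrow> j < n \<Longrightarrow> 0 \<le> A $$ (i, j)"
    and L: "L \<subseteq> {0..<n}"
    and y: "\<And>i. i < m \<Longrightarrow> 0 < y i"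
    and tight: "\<And>j. j \<in> L \<Longrightarrow> (\<Sum>i = 0..<m. y i * A $$ (i, j)) = c $ j"
    and slack: "\<And>j. j < n \<Longrightarrow> j \<notin> L \<Longrightarrow> c $ j < (\<Sum>i = 0..<m. y i * A $$ (i, j))"
    and indep: "\<And>z j. (\<And>i. i < m \<Longrightarrow> (\<Sum>j\<in>L. A $$ (i, j) * z j) = 0) \<Longrightarrow> j \<in> L \<Longrightarrow> z j = 0"
  shows "loadout A c L"
proof -
  define x where "x = vec n (\<lambda>j. if j \<in> L then 1 else 0 :: real)"
  define b where "b = A *\<^sub>v x"
  define s where "s j = (\<Sum>i = 0..<m. y i * A $$ (i, j)) - c $ j" for j
  have row: "(A *\<^sub>v z) $ i = (\<Sum>j = 0..<n. A $$ (i, j) * z $ j)"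
    if "i < m" "z \<in> carrier_vec n" for i z
    using that A by (auto simp: scalar_prod_def intro!: sum.cong)
  have obj: "c \<bullet> z = (\<Sum>i = 0..<m. y i * (A *\<^sub>v z) $ i) - (\<Sum>j = 0..<n. s j * z $ j)"
    if z: "z \<in> carrier_vec n" for z
  proof -
    have "(\<Sum>i = 0..<m. y i * (A *\<^sub>v z) $ i)
        = (\<Sum>i = 0..<m. \<Sum>j = 0..<n. y i * A $$ (i, j) * z $ j)"
      using z by (intro sum.cong) (auto simp: row sum_distrib_left mult.assoc simp del: index_mult_mat_vec)
    also have "\<dots> = (\<Sum>j = 0..<n. (\<Sum>i = 0..<m. y i * A $$ (i, j)) * z $ j)"
      by (subst sum.swap) (simp add: sum_distrib_right)
    finally show ?thesis
      using z by (simp add: scalar_prod_def s_def sum_subtractf[symmetric] algebra_simps)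
  qed
  have x: "x \<in> carrier_vec n" by (simp add: x_def)
  have s0: "s j = 0" if "j \<in> L" for j using tight[OF that] by (simp add: s_def)
  have s1: "0 < s j" if "j < n" "j \<notin> L" for j using slack[OF that] by (simp add: s_def)
  have s_nonneg: "0 \<le> s j" if "j < n" for j using s0 s1 that by (cases "j \<in> L") (auto simp: less_imp_le)
  have sx: "(\<Sum>j = 0..<n. s j * x $ j) = 0"
    by (intro sum.neutral) (auto simp: x_def s0)
  have b: "b \<in> carrier_vec m" unfolding b_def using A x by (rule mult_mat_vec_carrier)
  have "0 \<le> b $ i" if "i < m" for i
    unfolding b_def row[OF that x]
    by (intro sum_nonneg mult_nonneg_nonneg nonneg that) (auto simp: x_def)
  then have b0: "0\<^sub>v m \<le> b" using b by (auto simp: less_eq_vec_def)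
  have feas: "z \<in> lp_feasible A b \<longleftrightarrow> z \<in> carrier_vec n \<and> (\<forall>i<m. (A *\<^sub>v z) $ i \<le> b $ i) \<and> (\<forall>j<n. 0 \<le> z $ j)"
    for z
  proof -
    have dims: "dim_row A = m" "dim_col A = n" "dim_vec b = m" using A b by auto
    show ?thesis
    proof (cases "z \<in> carrier_vec n")
      case True
      then have "dim_vec z = n" by simp
      then show ?thesis
        using True by (simp add: lp_feasible_def less_eq_vec_def dims del: index_mult_mat_vec)
    qed (simp add: lp_feasible_def dims)
  qed
  have xf: "x \<in> lp_feasible A b"
    unfolding feas using x by (auto simp: b_def x_def simp del: index_mult_mat_vec)
  \<comment> \<open>The duality gap as a sum of complementary slackness products, which are
    nonnegative for feasible \<open>z\<close>. If \<open>z\<close> is optimal the gap is zero, so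
    every single product vanishes.\<close>
  have gap: "c \<bullet> x - c \<bullet> z = (\<Sum>i = 0..<m. y i * (b $ i - (A *\<^sub>v z) $ i)) + (\<Sum>j = 0..<n. s j * z $ j)"
    if "z \<in> carrier_vec n" for z
    unfolding obj[OF x] obj[OF that] sx b_def[symmetric]
    by (simp add: right_diff_distrib sum_subtractf del: index_mult_mat_vec)
  have terms: "(\<forall>i\<in>{0..<m}. 0 \<le> y i * (b $ i - (A *\<^sub>v z) $ i)) \<and> (\<forall>j\<in>{0..<n}. 0 \<le> s j * z $ j)"
    if "z \<in> lp_feasible A b" for z
    using that y[THEN less_imp_le] s_nonneg unfolding feas by (auto simp del: index_mult_mat_vec)
  have xopt: "lp_optimal A c b x"
    unfolding lp_optimal_def
  proof (intro conjI ballI)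
    fix z assume z: "z \<in> lp_feasible A b"
    then have zc: "z \<in> carrier_vec n" by (simp add: feas)
    have "0 \<le> c \<bullet> x - c \<bullet> z"
      unfolding gap[OF zc] using terms[OF z] by (intro add_nonneg_nonneg sum_nonneg) auto
    then show "c \<bullet> z \<le> c \<bullet> x" by simp
  qed (rule xf)
  have unique: "z = x" if opt: "lp_optimal A c b z" for z
  proof -
    have z: "z \<in> lp_feasible A b" and "c \<bullet> x \<le> c \<bullet> z"
      using opt xf by (auto simp: lp_optimal_def)
    moreover have zc: "z \<in> carrier_vec n" using z by (simp add: feas)
    moreover have nn: "0 \<le> (\<Sum>i = 0..<m. y i * (b $ i - (A *\<^sub>v z) $ i))" "0 \<le> (\<Sum>j = 0..<n. s j * z $ j)"
      using terms[OF z] by (blast intro: sum_nonneg)+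
    ultimately have zero: "(\<Sum>i = 0..<m. y i * (b $ i - (A *\<^sub>v z) $ i)) = 0" "(\<Sum>j = 0..<n. s j * z $ j) = 0"
      using gap[OF zc] by linarith+
    have rows: "(A *\<^sub>v z) $ i = b $ i" if "i < m" for i
    proof -
      have "y i * (b $ i - (A *\<^sub>v z) $ i) = 0"
        using sum_nonneg_0[OF finite_atLeastLessThan _ zero(1), of i] terms[OF z] that by auto
      then show ?thesis using y[OF that] by auto
    qed
    have off: "z $ j = 0" if "j < n" "j \<notin> L" for j
    proof -
      have "s j * z $ j = 0"
        using sum_nonneg_0[OF finite_atLeastLessThan _ zero(2), of j] terms[OF z] that by auto
      then show ?thesis using s1[OF that] by auto
    qed
    \<comment> \<open>Both \<open>z\<close> and \<open>x\<close> vanish off \<open>L\<close>, so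
      their difference is a kernel vector of \<open>A\<close> supported in \<open>L\<close>.\<close>
    have "(\<Sum>j\<in>L. A $$ (i, j) * (z $ j - x $ j)) = 0" if i: "i < m" for i
    proof -
      have "(\<Sum>j\<in>L. A $$ (i, j) * (z $ j - x $ j)) = (\<Sum>j = 0..<n. A $$ (i, j) * (z $ j - x $ j))"
        using L off by (intro sum.mono_neutral_left) (auto simp: x_def)
      also have "\<dots> = (A *\<^sub>v z) $ i - (A *\<^sub>v x) $ i"
        unfolding row[OF i zc] row[OF i x] by (simp add: right_diff_distrib sum_subtractf)
      finally show ?thesis using rows[OF i] by (simp add: b_def)
    qed
    then have on: "z $ j = x $ j" if "j \<in> L" for j
      using indep[of "\<lambda>j. z $ j - x $ j" j] that by simp
    show "z = x"
    proof (rule eq_vecI)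
      fix j assume "j < dim_vec x"
      then show "z $ j = x $ j" using on off by (cases "j \<in> L") (auto simp: x_def)
    qed (use zc x in auto)
  qed
  have "supp x = L" using L by (auto simp: supp_def x_def split: if_splits)
  moreover have "dim_row A = m" using A by simp
  ultimately show ?thesis
    unfolding loadout_def using b b0 xopt unique by blast
qed

text \<open>Needed for \<open>card_mono\<close>: lower bounds on \<open>card\<close> come from
  exhibited subfamilies, and \<open>card\<close> of an infinite set would be 0.\<close>

lemma finite_loadouts: "finite (loadouts k A c)"
proof -
  have "L \<subseteq> {0..<dim_col A}" if "loadout A c L" for L
  proof -
    from that obtain x where "x \<in> carrier_vec (dim_col A)" "supp x = L"
      unfolding loadout_def lp_optimal_def lp_feasible_def by blast
    moreover from this(1) have "dim_vec x = dim_col A" by (rule carrier_vecD)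
    ultimately show ?thesis by (force simp: supp_def)
  qed
  then have "loadouts k A c \<subseteq> Pow {0..<dim_col A}" unfolding loadouts_def by blast
  then show ?thesis by (rule finite_subset) simp
qed

section \<open>The design of the path and its dual vectors\<close>

definition path_mat :: "nat \<Rightarrow> real mat" where
  "path_mat n = mat 3 n (\<lambda>(i, j). if j < 2 then if i = j then 1 else 0
     else if i = 2 then (real j - 1)\<^sup>2 else 1)"

text \<open>The factor 8 is large enough that \<open>u + v\<close> exceeds 2 in the duals of
  \<open>loadout_edge_family\<close> and \<open>loadout_vertex_family\<close>. Hence one of
  \<open>u\<close>, \<open>v\<close> can be 1 while the other stays above 1.\<close>

definition path_cost :: "nat \<Rightarrow> real vec" where
  "path_cost n = vec n (\<lambda>j. if j < 2 then 1 else 8 * (real j - 1))"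

lemma design_path: "design 3 n (path_mat n) (path_cost n)"
  by (auto simp: design_def path_mat_def path_cost_def less_eq_vec_def)

text \<open>The certificate \<open>loadout_if_dual\<close> for the dual vector (u, v, w). The slacks
  of the points 0 and 1 are \<open>u - 1\<close> and \<open>v - 1\<close>, which gives the
  conditions on \<open>u\<close> and \<open>v\<close>.\<close>

lemma loadout_path:
  fixes u v w :: real
  assumes L: "L \<subseteq> {0..<n}" and w: "0 < w"
    and u: "1 \<le> u" "u = 1 \<longleftrightarrow> 0 \<in> L" and v: "1 \<le> v" "v = 1 \<longleftrightarrow> 1 \<in> L"
    and tight: "\<And>j. 2 \<le> j \<Longrightarrow> j \<in> L \<Longrightarrow> u + v + w * (real j - 1)\<^sup>2 - 8 * (real j - 1) = 0"
    and slack: "\<And>j. 2 \<le> j \<Longrightarrow> j \<notin> L \<Longrightarrow> 0 < u + v + w * (real j - 1)\<^sup>2 - 8 * (real j - 1)"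
    and indep: "\<And>z j. (\<And>i. i < 3 \<Longrightarrow> (\<Sum>j\<in>L. path_mat n $$ (i, j) * z j) = 0) \<Longrightarrow> j \<in> L \<Longrightarrow> z j = 0"
  shows "loadout (path_mat n) (path_cost n) L"
proof -
  define y where "y i = (if i = 0 then u else if i = 1 then v else w)" for i :: nat
  have dual: "(\<Sum>i = 0..<3. y i * path_mat n $$ (i, j)) =
      (if j = 0 then u else if j = 1 then v else u + v + w * (real j - 1)\<^sup>2)" if "j < n" for j
    using that by (auto simp: eval_nat_numeral y_def path_mat_def)
  have cost: "path_cost n $ j = (if j < 2 then 1 else 8 * (real j - 1))" if "j < n" for j
    using that by (simp add: path_cost_def)
  show ?thesis
  proof (rule loadout_if_dual[where m = 3 and n = n and y = y])
    fix j assume j: "j \<in> L"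
    then have "j < n" using L by auto
    then show "(\<Sum>i = 0..<3. y i * path_mat n $$ (i, j)) = path_cost n $ j"
      using j u v tight[of j] unfolding dual[OF \<open>j < n\<close>] cost[OF \<open>j < n\<close>]
      by (cases "j = 0"; cases "j = 1") auto
  next
    fix j assume j: "j < n" "j \<notin> L"
    consider "j = 0" | "j = 1" | "2 \<le> j" by linarith
    then show "path_cost n $ j < (\<Sum>i = 0..<3. y i * path_mat n $$ (i, j))"
    proof cases
      case 1
      then have "u \<noteq> 1" using j(2) u(2) by simp
      then have "1 < u" using u(1) by simp
      then show ?thesis unfolding dual[OF j(1)] cost[OF j(1)] using 1 by simp
    next
      case 2
      then have "v \<noteq> 1" using j(2) v(2) by simp
      then have "1 < v" using v(1) by simp
      then show ?thesis unfolding dual[OF j(1)] cost[OF j(1)] using 2 by simp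
    next
      case 3
      then show ?thesis unfolding dual[OF j(1)] cost[OF j(1)] using slack[OF 3 j(2)] by simp
    qed
  next
    fix z :: "nat \<Rightarrow> real" and j
    assume "\<And>i. i < 3 \<Longrightarrow> (\<Sum>j\<in>L. path_mat n $$ (i, j) * z j) = 0" "j \<in> L"
    then show "z j = 0" by (rule indep)
  qed (use L w u(1) v(1) in \<open>auto simp: y_def path_mat_def path_cost_def\<close>)
qed

section \<open>Slack quadratics with prescribed roots\<close>

text \<open>The product is negative only strictly between \<open>j\<close> and \<open>j + 1\<close>,
  where there is no natural number.\<close>

lemma consecutive_roots_pos:
  fixes a j :: nat
  assumes "a \<noteq> j" "a \<noteq> Suc j"
  shows "0 < (real a - real j) * (real a - real j - 1)"
proof (cases "a < j")
  case True
  then have "real a < real j" by simp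
  then show ?thesis by (intro mult_neg_neg) auto
next
  case False
  then have "real (Suc j) < real a" using assms by (simp only: of_nat_less_iff)
  then show ?thesis by (intro mult_pos_pos) auto
qed

text \<open>Vieta's formulas in k = t - 1 for the roots j - 1 and j:
  \<open>w * (2 * j - 1) = 8\<close> and \<open>u + v = w * (j - 1) * j\<close>.\<close>

lemma slack_edge:
  fixes j t :: real
  assumes "2 \<le> j"
  shows "8 * (j - 1) * j / (2 * j - 1) + 8 / (2 * j - 1) * (t - 1)\<^sup>2 - 8 * (t - 1)
    = 8 / (2 * j - 1) * ((t - j) * (t - j - 1))"
  using assms by (simp add: divide_simps) (simp add: algebra_simps power2_eq_square)

text \<open>The same for a double root at k = j - 1: \<open>2 * w * (j - 1) = 8\<close> and
  \<open>u + v = w * (j - 1)\<^sup>2\<close>.\<close>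

lemma slack_vertex:
  fixes j t :: real
  assumes "2 \<le> j"
  shows "4 * (j - 1) + 4 / (j - 1) * (t - 1)\<^sup>2 - 8 * (t - 1) = 4 / (j - 1) * (t - j)\<^sup>2"
  using assms by (simp add: divide_simps) (simp add: algebra_simps power2_eq_square)

lemma slack_edge_sum:
  fixes j :: real
  assumes "2 \<le> j"
  shows "2 < 8 * (j - 1) * j / (2 * j - 1)"
proof -
  have "2 * (2 * j - 1) < 4 * (2 * j - 1)" using assms by simp
  also have "\<dots> \<le> 4 * (2 * j - 1) + 8 * (j - 2) * j" using assms by simp
  also have "\<dots> \<le> 8 * (j - 1) * j" by (simp add: algebra_simps)
  finally show ?thesis using assms by (simp add: pos_less_divide_eq)
qed

section \<open>Realising the edges and triangles\<close>

text \<open>Empty \<open>K\<close> gives the edges of the path; a singleton \<open>K\<close> gives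
  the triangles that join such an edge to 0 or 1.\<close>

lemma loadout_edge_family:
  assumes j: "2 \<le> j" "Suc j < n" and K: "K = {} \<or> K = {0} \<or> K = {1}"
  shows "loadout (path_mat n) (path_cost n) (K \<union> {j, Suc j})"
proof -
  define r where "r = 8 * (real j - 1) * real j / (2 * real j - 1)"
  \<comment> \<open>Splits \<open>r = u + v\<close>: the point in \<open>K\<close> gets the value 1
    and the other gets \<open>r - 1 > 1\<close>; for empty \<open>K\<close> both halves exceed
    1.\<close>
  define u where "u = (if 0 \<in> K then 1 else if 1 \<in> K then r - 1 else r / 2)"
  have r: "2 < r" using slack_edge_sum[of "real j"] j by (simp add: r_def)
  have q: "u + (r - u) + 8 / (2 * real j - 1) * (real t - 1)\<^sup>2 - 8 * (real t - 1)
      = 8 / (2 * real j - 1) * ((real t - real j) * (real t - real j - 1))" for t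
    using slack_edge[of "real j" "real t"] j by (simp add: r_def)
  show ?thesis
  proof (rule loadout_path[where u = u and v = "r - u" and w = "8 / (2 * real j - 1)"])
    fix t assume "2 \<le> t" "t \<in> K \<union> {j, Suc j}"
    then show "u + (r - u) + 8 / (2 * real j - 1) * (real t - 1)\<^sup>2 - 8 * (real t - 1) = 0"
      unfolding q using K by auto
  next
    fix t assume "2 \<le> t" "t \<notin> K \<union> {j, Suc j}"
    then show "0 < u + (r - u) + 8 / (2 * real j - 1) * (real t - 1)\<^sup>2 - 8 * (real t - 1)"
      unfolding q using j by (intro mult_pos_pos consecutive_roots_pos) auto
  next
    fix z :: "nat \<Rightarrow> real" and t
    assume eqs: "\<And>i. i < 3 \<Longrightarrow> (\<Sum>k\<in>K \<union> {j, Suc j}. path_mat n $$ (i, k) * z k) = 0" and t: "t \<in> K \<union> {j, Suc j}"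
    \<comment> \<open>The third row is zero in columns 0 and 1, and one of the first two rows is
      zero in the column of \<open>K\<close>. These two rows give a system in \<open>z j\<close> and
      \<open>z (Suc j)\<close> with determinant \<open>2 * j - 1\<close>.\<close>
    have e2: "(real j - 1)\<^sup>2 * z j + (real j)\<^sup>2 * z (Suc j) = 0"
      using eqs[of 2] K j by (auto simp: path_mat_def)
    have e01: "z j + z (Suc j) = 0"
      using eqs[of 0] eqs[of 1] K j by (auto simp: path_mat_def)
    have "z j * (2 * real j - 1) = 0"
    proof -
      have "z (Suc j) = - z j" using e01 by simp
      then show ?thesis using e2 by (simp add: algebra_simps power2_eq_square)
    qed
    then have "z j = 0" using j by auto
    then show "z t = 0"
      using e01 t eqs[of 0] eqs[of 1] K j by (auto simp: path_mat_def)
  qed (use j r K in \<open>auto simp: u_def\<close>)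
qed

text \<open>A slack quadratic with a double root at \<open>j\<close> is positive at all other path
  vertices.\<close>

lemma loadout_vertex_family:
  assumes j: "2 \<le> j" "j < n" and k: "k < 2"
  shows "loadout (path_mat n) (path_cost n) {k, j}"
proof -
  define u where "u = (if k = 0 then 1 else 4 * (real j - 1) - 1)"
  have q: "u + (4 * (real j - 1) - u) + 4 / (real j - 1) * (real t - 1)\<^sup>2 - 8 * (real t - 1)
      = 4 / (real j - 1) * (real t - real j)\<^sup>2" for t
    using slack_vertex[of "real j" "real t"] j by simp
  show ?thesis
  proof (rule loadout_path[where u = u and v = "4 * (real j - 1) - u" and w = "4 / (real j - 1)"])
    fix t assume "2 \<le> t" "t \<in> {k, j}"
    then show "u + (4 * (real j - 1) - u) + 4 / (real j - 1) * (real t - 1)\<^sup>2 - 8 * (real t - 1) = 0"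
      unfolding q using k by auto
  next
    fix t assume "2 \<le> t" "t \<notin> {k, j}"
    then show "0 < u + (4 * (real j - 1) - u) + 4 / (real j - 1) * (real t - 1)\<^sup>2 - 8 * (real t - 1)"
      unfolding q using j by (intro mult_pos_pos) auto
  next
    fix z :: "nat \<Rightarrow> real" and t
    assume eqs: "\<And>i. i < 3 \<Longrightarrow> (\<Sum>l\<in>{k, j}. path_mat n $$ (i, l) * z l) = 0" and t: "t \<in> {k, j}"
    have "z j = 0" using eqs[of 2] j k by (auto simp: path_mat_def)
    then show "z t = 0"
      using t eqs[of k] j k by (auto simp: path_mat_def)
  qed (use j k in \<open>auto simp: u_def\<close>)
qed

text \<open>With \<open>u = v = 1\<close>, the choice \<open>w = 8\<close> puts a double root at t =
  3/2, just before the path begins at 2.\<close>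

lemma loadout_01:
  assumes "2 < n"
  shows "loadout (path_mat n) (path_cost n) {0, 1}"
proof (rule loadout_path[where u = 1 and v = 1 and w = 8])
  fix t :: nat assume "2 \<le> t"
  have "1 + 1 + 8 * (real t - 1)\<^sup>2 - 8 * (real t - 1) = 2 * (2 * real t - 3)\<^sup>2"
    by (simp add: algebra_simps power2_eq_square)
  moreover have "0 < (2 * real t - 3)\<^sup>2" using \<open>2 \<le> t\<close> by auto
  ultimately show "0 < 1 + 1 + 8 * (real t - 1)\<^sup>2 - 8 * (real t - 1)" by simp
next
  fix z :: "nat \<Rightarrow> real" and t :: nat
  assume "\<And>i. i < 3 \<Longrightarrow> (\<Sum>l\<in>{0, 1}. path_mat n $$ (i, l) * z l) = 0" and "t \<in> {0, 1}"
  from this(1)[of 0] this(1)[of 1] this(2) show "z t = 0"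
    using assms by (auto simp: path_mat_def)
qed (use assms in auto)

text \<open>With \<open>u = v = 1\<close>, tightness at vertex 2 forces \<open>w = 6\<close>. The
  second root t = 4/3 lies before the path.\<close>

lemma loadout_012:
  assumes "2 < n"
  shows "loadout (path_mat n) (path_cost n) {0, 1, 2}"
proof (rule loadout_path[where u = 1 and v = 1 and w = 6])
  fix t :: nat assume "2 \<le> t" "t \<notin> {0, 1, 2}"
  have "1 + 1 + 6 * (real t - 1)\<^sup>2 - 8 * (real t - 1) = 2 * ((3 * real t - 4) * (real t - 2))"
    by (simp add: algebra_simps power2_eq_square)
  moreover have "0 < (3 * real t - 4) * (real t - 2)"
    using \<open>2 \<le> t\<close> \<open>t \<notin> {0, 1, 2}\<close> by (intro mult_pos_pos) auto
  ultimately show "0 < 1 + 1 + 6 * (real t - 1)\<^sup>2 - 8 * (real t - 1)" by simp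
next
  fix z :: "nat \<Rightarrow> real" and t :: nat
  assume "\<And>i. i < 3 \<Longrightarrow> (\<Sum>l\<in>{0, 1, 2}. path_mat n $$ (i, l) * z l) = 0" and "t \<in> {0, 1, 2}"
  from this(1)[of 0] this(1)[of 1] this(1)[of 2] this(2) show "z t = 0"
    using assms by (auto simp: path_mat_def)
qed (use assms in auto)

section \<open>Counting triangles and edges\<close>

text \<open>Each of the n - 3 path edges is joined to 0 and to 1, and {0, 1, 2} is one more
  triangle: 2(n - 3) + 1 = 2n - 5.\<close>

lemma card_loadouts_3_path:
  assumes "3 < n"
  shows "2 * n - 5 \<le> card (loadouts 3 (path_mat n) (path_cost n))"
proof -
  define F where "F k = (\<lambda>j. {k, j, Suc j}) ` {2..<n - 1}" for k :: nat
  have inj: "inj_on (\<lambda>j. {k, j, Suc j}) {2..<n - 1}" if "k < 2" for k :: nat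
  proof (rule inj_onI)
    fix i j assume ij: "i \<in> {2..<n - 1}" "j \<in> {2..<n - 1}" and eq: "{k, i, Suc i} = {k, j, Suc j}"
    then have "i \<in> {k, j, Suc j}" "j \<in> {k, i, Suc i}" by auto
    then show "i = j" using ij that by auto
  qed
  have card: "card (F k) = n - 3" if "k < 2" for k
    unfolding F_def using card_image[OF inj[OF that]] by simp
  \<comment> \<open>Membership of 0 and 1 tells the families apart.\<close>
  have "0 \<in> X \<and> 1 \<notin> X" if "X \<in> F 0" for X using that by (auto simp: F_def)
  moreover have "0 \<notin> X" if "X \<in> F 1" for X using that by (auto simp: F_def)
  ultimately have d1: "F 0 \<inter> F 1 = {}" and d2: "{0, 1, 2} \<notin> F 0 \<union> F 1" by blast+
  have "card (insert {0, 1, 2} (F 0 \<union> F 1)) = Suc (card (F 0) + card (F 1))"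
    using d1 d2 by (simp add: card_Un_disjoint F_def)
  then have "card (insert {0, 1, 2} (F 0 \<union> F 1)) = 2 * n - 5" using assms by (simp add: card)
  moreover have "F k \<subseteq> loadouts 3 (path_mat n) (path_cost n)" if k: "k < 2" for k
  proof
    fix X assume "X \<in> F k"
    then obtain j where j: "2 \<le> j" "Suc j < n" and X: "X = {k, j, Suc j}"
      by (auto simp: F_def)
    have "{k} = {} \<or> {k} = {0} \<or> {k} = {1}" using k by auto
    then have "loadout (path_mat n) (path_cost n) ({k} \<union> {j, Suc j})"
      by (rule loadout_edge_family[OF j])
    moreover have "{k} \<union> {j, Suc j} = X" unfolding X by blast
    ultimately have "loadout (path_mat n) (path_cost n) X" by (simp only:)
    moreover have "card X = 3" using X j k by simp
    ultimately show "X \<in> loadouts 3 (path_mat n) (path_cost n)" by (simp add: loadouts_def)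
  qed
  ultimately show ?thesis
    using card_mono[OF finite_loadouts, of "insert {0, 1, 2} (F 0 \<union> F 1)" 3 "path_mat n" "path_cost n"]
      assms loadout_012[of n] by (simp add: loadouts_def)
qed

text \<open>There are n - 2 edges from each of 0 and 1 to the path, n - 3 edges on the path, and the
  edge {0, 1}: 2(n - 2) + (n - 3) + 1 = 3n - 6.\<close>

lemma card_loadouts_2_path:
  assumes "3 < n"
  shows "3 * n - 6 \<le> card (loadouts 2 (path_mat n) (path_cost n))"
proof -
  define F where "F k = (\<lambda>j. {k, j}) ` {2..<n}" for k :: nat
  define E where "E = (\<lambda>j. {j, Suc j}) ` {2..<n - 1}"
  have "inj_on (\<lambda>j. {k, j}) {2..<n}" for k :: nat
    by (auto simp: inj_on_def doubleton_eq_iff)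
  then have cF: "card (F k) = n - 2" for k
    unfolding F_def by (subst card_image) auto
  have "inj_on (\<lambda>j. {j, Suc j}) {2..<n - 1}"
    by (auto simp: inj_on_def doubleton_eq_iff)
  then have cE: "card E = n - 3"
    unfolding E_def by (subst card_image) auto
  have "0 \<in> X \<and> 1 \<notin> X" if "X \<in> F 0" for X using that by (auto simp: F_def)
  moreover have "0 \<notin> X \<and> 1 \<in> X" if "X \<in> F 1" for X using that by (auto simp: F_def)
  moreover have "0 \<notin> X \<and> 1 \<notin> X" if "X \<in> E" for X using that by (auto simp: E_def)
  ultimately have d: "F 0 \<inter> F 1 = {}" "(F 0 \<union> F 1) \<inter> E = {}" "{0, 1} \<notin> F 0 \<union> F 1 \<union> E"
    by blast+
  have fin: "finite (F 0)" "finite (F 1)" "finite E" by (auto simp: F_def E_def)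
  have "card (insert {0, 1} (F 0 \<union> F 1 \<union> E)) = 3 * n - 6"
    using d fin cF cE assms by (simp add: card_Un_disjoint)
  moreover have "F k \<subseteq> loadouts 2 (path_mat n) (path_cost n)" if "k < 2" for k
    using that loadout_vertex_family by (auto simp: F_def loadouts_def)
  moreover have "E \<subseteq> loadouts 2 (path_mat n) (path_cost n)"
    using loadout_edge_family[of _ n "{}"] by (auto simp: E_def loadouts_def)
  ultimately show ?thesis
    using card_mono[OF finite_loadouts, of "insert {0, 1} (F 0 \<union> F 1 \<union> E)" 2 "path_mat n" "path_cost n"]
      assms loadout_01[of n] by (simp add: loadouts_def)
qed

theorem theorem3:
  fixes n :: nat
  assumes "n > 3"
  shows "\<exists>A c. design 3 n A c \<and>
           card (loadouts 3 A c) \<ge> 2 * n - 5 \<and>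
           card (loadouts 2 A c) \<ge> 3 * n - 6"
  using design_path card_loadouts_3_path[OF assms] card_loadouts_2_path[OF assms] by blast

end
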